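(* Let $|q|<1$ and $x\in\mathbb{C}$. Then \[ \sum_{n\geq 0} \frac{q^{2n^2+2n}\prod_{i=1}^n (1+2xq^{2i-1}+q^{4i-2})}{(q^2;q^2)_{2n}} =\frac{1}{(q^2;q^2)_\infty}\sum_{n\geq 0} (-1)^n q^{ n^2+n} \sum_{j=0}^{\lfloor\frac{n}{2} \rfloor} q^{-j^2}\big(V_j(x)+V_{j-1}(x)\big). \]
   Context: $(a;q)_n=\prod_{k=0}^{n-1}(1-aq^k)$, $(a;q)_\infty=\prod_{k\ge0}(1-aq^k)$. $V_n(x)$ is the Chebyshev polynomial of the third kind: $V_0=1$, $V_1=2x-1$, $V_n=2xV_{n-1}-V_{n-2}$ ($n>1$), and $V_n=0$ for $n<0$. *)

theory Defs
  imports "HOL-Analysis.Analysis"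
begin

definition qpoch :: "complex \<Rightarrow> complex \<Rightarrow> nat \<Rightarrow> complex" where
  "qpoch a q n = (\<Prod>k<n. 1 - a * q ^ k)"

definition qpoch_inf :: "complex \<Rightarrow> complex \<Rightarrow> complex" where
  "qpoch_inf a q = (\<Prod>k. 1 - a * q ^ k)"

(* prodinf is only meaningful for convergent products. *)
lemma convergent_prod_qpoch_inf:
  fixes a q :: complex
  assumes "norm q < 1"
  shows "convergent_prod (\<lambda>k. 1 - a * q ^ k)"
proof -
  have "summable (\<lambda>k. norm (a * q ^ k))"
    unfolding norm_mult norm_power using assms
    by (intro summable_mult summable_geometric) simp
  hence "abs_convergent_prod (\<lambda>k. 1 - a * q ^ k)"
    by (simp add: abs_convergent_prod_conv_summable)
  thus ?thesis
    by (rule abs_convergent_prod_imp_convergent_prod)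
qed

function chebyshev_V :: "int \<Rightarrow> complex \<Rightarrow> complex" where
  "chebyshev_V n x =
     (if n < 0 then 0
      else if n = 0 then 1
      else if n = 1 then 2 * x - 1
      else 2 * x * chebyshev_V (n - 1) x - chebyshev_V (n - 2) x)"
  by auto
termination by (relation "Wellfounded.measure (\<lambda>(n, x). nat n)") auto

(* The unconditional equation makes the simplifier loop. *)
declare chebyshev_V.simps [simp del]

end

theory Submission
  imports Defs
begin

text \<open>
  If \<open>2x = z + 1/z\<close>, then \<open>V\<^sub>j(x) + V\<^bsub>j-1\<^esub>(x)\<close> equals \<open>z\<^sup>j + z\<^bsup>-j\<^esup>\<close> for \<open>j > 0\<close> and \<open>1\<close> for
  \<open>j = 0\<close>, so the finite Jacobi triple product expands the product on the left-hand side in these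
  quantities. Put \<open>Q = q\<^sup>2\<close>. Comparing their coefficients on both sides leaves, with \<open>N = 2j\<close>,
  \<open>\<Sum>\<^sub>m Q\<^bsup>m\<^sup>2+m(N+1)\<^esup> / ((Q;Q)\<^sub>m (Q;Q)\<^bsub>m+N\<^esub>) = 1/(Q;Q)\<^sub>\<infinity> \<Sum>\<^sub>k (-1)\<^sup>k Q\<^bsup>k(k+1)/2+Nk\<^esup>\<close>.
  If \<open>R\<^sub>N\<close> denotes either side times \<open>(Q;Q)\<^sub>\<infinity>\<close>, then \<open>R\<^sub>N = 1 - Q\<^bsup>N+1\<^esup> R\<^bsub>N+1\<^esub>\<close>, and this recurrence
  has only one bounded solution. For the left side the recurrence is the Durfee rectangle identity
  \<open>\<Sum>\<^sub>m Q\<^bsup>m\<^sup>2+mM\<^esup> / ((Q;Q)\<^sub>m (Q;Q)\<^bsub>m+M\<^esub>) = 1/(Q;Q)\<^sub>\<infinity>\<close>: the same uniqueness argument shows that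
  the sum does not depend on \<open>M\<close>, and one lets \<open>M\<close> tend to infinity.
\<close>

section \<open>The Chebyshev combinations V_j + V_{j-1}\<close>

text \<open>For \<open>j > 0\<close> this is twice the Chebyshev polynomial of the first kind T_j;
  at \<open>j = 0\<close> the convention V_{-1} = 0 gives 1 instead of 2 T_0 = 2.\<close>

definition cheb_VV :: "complex \<Rightarrow> nat \<Rightarrow> complex" where
  "cheb_VV x j = chebyshev_V (int j) x + chebyshev_V (int j - 1) x"

lemma cheb_VV_0 [simp]: "cheb_VV x 0 = 1"
  by (simp add: cheb_VV_def chebyshev_V.simps)

lemma cheb_VV_1 [simp]: "cheb_VV x (Suc 0) = 2 * x"
  by (simp add: cheb_VV_def chebyshev_V.simps)

text \<open>The three-term recurrence is that of 2 T_j; the exceptional 2 at \<open>j = 0\<close> is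
  2 T_0, which is twice \<open>cheb_VV x 0\<close>.\<close>

lemma cheb_VV_Suc_Suc:
  "cheb_VV x (Suc (Suc j)) = 2 * x * cheb_VV x (Suc j) - (if j = 0 then 2 else cheb_VV x j)"
proof -
  have V: "chebyshev_V (int (Suc (Suc k))) x
      = 2 * x * chebyshev_V (int (Suc k)) x - chebyshev_V (int k) x" for k
    by (subst chebyshev_V.simps) (simp add: algebra_simps)
  have V0: "chebyshev_V 0 x = 1" and V1: "chebyshev_V 1 x = 2 * x - 1"
    by (simp_all add: chebyshev_V.simps)
  show ?thesis
  proof (cases j)
    case 0
    then show ?thesis
      using V[of 0] by (simp add: cheb_VV_def V0 V1 algebra_simps)
  next
    case (Suc i)
    then show ?thesis
      using V[of "Suc i"] V[of i] by (simp add: cheb_VV_def algebra_simps)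
  qed
qed

text \<open>Crude exponential growth is enough, because these values only meet powers of
  \<open>q\<close> whose exponent is at least quadratic in \<open>j\<close>.\<close>

lemma norm_cheb_VV_le: "norm (cheb_VV x j) \<le> (2 * norm x + 2) ^ j"
proof (induction j rule: induct_nat_012)
  case 0
  show ?case by simp
next
  case 1
  show ?case by (simp add: norm_mult)
next
  case (ge2 j)
  define K where "K = 2 * norm x + 2"
  have K: "K \<ge> 2" by (simp add: K_def)
  have "0 \<le> K ^ j" using K by simp
  \<comment> \<open>The factor 2 leaves room for the exceptional value 2 at
    \<open>j = 0\<close>.\<close>
  with ge2(1) have "norm (cheb_VV x j) \<le> 2 * K ^ j"
    unfolding K_def by linarith
  hence "norm (if j = 0 then 2 else cheb_VV x j) \<le> 2 * K ^ j" by auto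
  also have "\<dots> \<le> 2 * K ^ Suc j"
    using K by (intro mult_left_mono power_increasing) auto
  finally have 1: "norm (if j = 0 then 2 else cheb_VV x j) \<le> 2 * K ^ Suc j" .
  have 2: "norm (2 * x * cheb_VV x (Suc j)) \<le> 2 * norm x * K ^ Suc j"
    using ge2(2) by (auto simp: norm_mult K_def intro!: mult_left_mono)
  have "norm (cheb_VV x (Suc (Suc j))) \<le> 2 * norm x * K ^ Suc j + 2 * K ^ Suc j"
    unfolding cheb_VV_Suc_Suc using norm_triangle_ineq4 1 2 by (meson add_mono order_trans)
  also have "\<dots> = K ^ Suc (Suc j)" by (simp add: K_def algebra_simps)
  finally show ?case by (simp add: K_def)
qed

text \<open>The terms are at most \<open>(K * norm q ^ j) ^ j\<close>; the base tends to 0, so from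
  some point on a geometric series of ratio 1/2 dominates.\<close>

lemma summable_cheb_VV_mult_power_square:
  assumes "norm q < 1" "\<And>j. j ^ 2 \<le> e j"
  shows "summable (\<lambda>j. norm (cheb_VV x j * q ^ e j))"
proof -
  define K where "K = 2 * norm x + 2"
  have K: "K \<ge> 2" by (simp add: K_def)
  have "(\<lambda>j. K * norm q ^ j) \<longlonglongrightarrow> K * 0"
    using assms(1) by (intro tendsto_mult tendsto_const LIMSEQ_power_zero) auto
  hence "\<forall>\<^sub>F j in sequentially. K * norm q ^ j < 1/2"
    by (rule order_tendstoD) simp
  hence "\<forall>\<^sub>F j in sequentially. norm (norm (cheb_VV x j * q ^ e j)) \<le> (1/2) ^ j"
  proof eventually_elim
    case (elim j)
    have "norm (cheb_VV x j * q ^ e j) \<le> K ^ j * norm q ^ (j ^ 2)"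
      unfolding norm_mult norm_power using assms norm_cheb_VV_le[of x j] K
      by (intro mult_mono power_decreasing) (auto simp: K_def)
    also have "\<dots> = (K * norm q ^ j) ^ j"
      by (simp add: power_mult_distrib power_mult power2_eq_square)
    also have "\<dots> \<le> (1/2) ^ j"
      using elim K by (intro power_mono) auto
    finally show ?case by simp
  qed
  thus ?thesis
    by (rule summable_comparison_test_ev) (simp add: summable_geometric)
qed

section \<open>The symbols (Q;Q)_n and their limit\<close>

lemma qpoch_0 [simp]: "qpoch a q 0 = 1"
  by (simp add: qpoch_def)

lemma qpoch_Suc: "qpoch a q (Suc n) = qpoch a q n * (1 - a * q ^ n)"
  by (simp add: qpoch_def)

lemma one_minus_power_neq_0:
  fixes Q :: complex
  assumes "norm Q < 1"
  shows "1 - Q * Q ^ n \<noteq> 0"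
proof
  assume "1 - Q * Q ^ n = 0"
  hence "Q ^ Suc n = 1" by (simp only: power_Suc eq_iff_diff_eq_0[of 1] eq_commute[of _ 1])
  hence "norm Q ^ Suc n = 1" by (metis norm_power norm_one)
  moreover have "norm Q ^ Suc n < 1"
    using assms by (simp only: power_less_one_iff norm_ge_zero zero_less_Suc simp_thms)
  ultimately show False by simp
qed

lemma qpoch_neq_0:
  assumes "norm Q < 1"
  shows "qpoch Q Q n \<noteq> 0"
  using one_minus_power_neq_0[OF assms] by (simp add: qpoch_def)

lemma qpoch_tendsto:
  assumes "norm Q < 1"
  shows "qpoch Q Q \<longlonglongrightarrow> qpoch_inf Q Q"
proof -
  have "(\<lambda>n. \<Prod>k\<le>n. 1 - Q * Q ^ k) \<longlonglongrightarrow> qpoch_inf Q Q"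
    unfolding qpoch_inf_def
    by (rule convergent_prod_LIMSEQ[OF convergent_prod_qpoch_inf[OF assms]])
  hence "(\<lambda>n. qpoch Q Q (Suc n)) \<longlonglongrightarrow> qpoch_inf Q Q"
    by (simp add: qpoch_def lessThan_Suc_atMost del: prod.lessThan_Suc)
  thus ?thesis by (rule LIMSEQ_imp_Suc)
qed

lemma qpoch_inf_neq_0:
  assumes "norm Q < 1"
  shows "qpoch_inf Q Q \<noteq> 0"
  unfolding qpoch_inf_def
  using prodinf_nonzero[OF convergent_prod_qpoch_inf[OF assms]] one_minus_power_neq_0[OF assms]
  by blast

lemma inverse_qpoch_tendsto:
  assumes "norm Q < 1"
  shows "(\<lambda>n. 1 / qpoch Q Q n) \<longlonglongrightarrow> 1 / qpoch_inf Q Q"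
  by (intro tendsto_divide tendsto_const qpoch_tendsto qpoch_inf_neq_0 assms)

text \<open>The reciprocals converge since the infinite product is nonzero; this bound, uniform in
  \<open>n\<close>, drives the estimates of all Durfee-type sums.\<close>

lemma inverse_qpoch_bounded:
  assumes "norm Q < 1"
  obtains B where "B > 0" "\<And>n. norm (1 / qpoch Q Q n) \<le> B"
proof -
  have "Bseq (\<lambda>n. 1 / qpoch Q Q n)"
    using inverse_qpoch_tendsto[OF assms] convergentI convergent_imp_Bseq by blast
  thus ?thesis using that unfolding Bseq_def by blast
qed

section \<open>Uniqueness of bounded solutions\<close>

text \<open>Iterating the recurrence \<open>k\<close> times gives
  \<open>norm (D n) \<le> norm Q ^ k * B\<close> with one \<open>B\<close> for all indices; then
  \<open>k\<close> tends to infinity.\<close>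

lemma eq_0_if_shift_contraction:
  fixes D :: "nat \<Rightarrow> complex"
  assumes Q: "norm Q < 1" and rec: "\<And>n. D n = - (Q ^ Suc n * D (Suc n))"
    and bound: "\<And>n. norm (D n) \<le> B"
  shows "D n = 0"
proof -
  have "norm (D n) \<le> norm Q ^ k * B" for k
  proof (induction k arbitrary: n)
    case 0
    show ?case using bound by simp
  next
    case (Suc k)
    have "norm (D n) = norm Q ^ Suc n * norm (D (Suc n))"
      by (subst rec) (simp add: norm_mult norm_power)
    \<comment> \<open>As \<open>Suc n\<close> is at least 1, each iteration gains at least one
      factor \<open>norm Q\<close>.\<close>
    also have "\<dots> \<le> norm Q ^ 1 * (norm Q ^ k * B)"
      using Q Suc.IH by (intro mult_mono power_decreasing) auto
    finally show ?case by simp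
  qed
  moreover have "(\<lambda>k. norm Q ^ k * B) \<longlonglongrightarrow> 0 * B"
    using Q by (intro tendsto_mult tendsto_const LIMSEQ_power_zero) auto
  ultimately have "norm (D n) \<le> 0"
    using LIMSEQ_le_const by fastforce
  thus ?thesis by simp
qed

section \<open>Durfee rectangle sums\<close>

text \<open>Two parameters are kept apart: \<open>L = N\<close> gives the Durfee rectangle sums,
  while the comparison of coefficients leads to \<open>L = Suc N\<close>.\<close>

definition durfee_term :: "complex \<Rightarrow> nat \<Rightarrow> nat \<Rightarrow> nat \<Rightarrow> complex" where
  "durfee_term Q L N m = Q ^ (m ^ 2 + m * L) / (qpoch Q Q m * qpoch Q Q (m + N))"

text \<open>The full exponent is retained so that the terms with \<open>m > 0\<close> can be seen to
  decay as \<open>L\<close> grows.\<close>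

lemma durfee_term_bound:
  assumes "norm Q < 1"
  obtains B where "B > 0" "\<And>L N m. norm (durfee_term Q L N m) \<le> B * norm Q ^ (m ^ 2 + m * L)"
proof -
  obtain B where B: "B > 0" "\<And>n. norm (1 / qpoch Q Q n) \<le> B"
    using that by (rule inverse_qpoch_bounded[OF assms])
  have "norm (durfee_term Q L N m) \<le> (B * B) * norm Q ^ (m ^ 2 + m * L)" for L N m
  proof -
    have "durfee_term Q L N m = (1 / qpoch Q Q m) * (1 / qpoch Q Q (m + N)) * Q ^ (m ^ 2 + m * L)"
      by (simp add: durfee_term_def)
    also have "norm \<dots> \<le> (B * B) * norm Q ^ (m ^ 2 + m * L)"
      unfolding norm_mult norm_power
      using B by (intro mult_right_mono mult_mono) auto
    finally show ?thesis .
  qed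
  thus ?thesis using that[of "B * B"] B(1) by simp
qed

lemma durfee_term_geometric_bound:
  assumes "norm Q < 1"
  obtains B where "B > 0" "\<And>L N m. norm (durfee_term Q L N m) \<le> B * norm Q ^ m"
proof -
  obtain B where B: "B > 0"
    "\<And>L N m. norm (durfee_term Q L N m) \<le> B * norm Q ^ (m ^ 2 + m * L)"
    using that by (rule durfee_term_bound[OF assms])
  have "norm (durfee_term Q L N m) \<le> B * norm Q ^ m" for L N m
  proof -
    have "m \<le> m ^ 2 + m * L"
      by (simp add: power2_eq_square trans_le_add1)
    hence "B * norm Q ^ (m ^ 2 + m * L) \<le> B * norm Q ^ m"
      using B(1) assms by (intro mult_left_mono power_decreasing) auto
    thus ?thesis using B(2) order_trans by blast
  qed
  thus ?thesis using that B(1) by blast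
qed

lemma norm_suminf_le_geometric:
  fixes f :: "nat \<Rightarrow> complex"
  assumes "0 \<le> r" "r < 1" "\<And>m. norm (f m) \<le> B * r ^ m"
  shows "summable f" "norm (suminf f) \<le> B / (1 - r)"
proof -
  have g: "(\<lambda>m. B * r ^ m) sums (B * (1 / (1 - r)))"
    using assms by (intro sums_mult geometric_sums) auto
  show "summable f"
    using sums_summable[OF g] assms(3) by (rule summable_comparison_test')
  have "norm (suminf f) \<le> (\<Sum>m. B * r ^ m)"
    using assms(3) sums_summable[OF g] by (intro norm_suminf_le) auto
  thus "norm (suminf f) \<le> B / (1 - r)"
    using sums_unique[OF g] by simp
qed

lemma summable_durfee_term:
  assumes "norm Q < 1"
  shows "summable (durfee_term Q L N)"
proof -
  obtain B where "B > 0" and "\<And>L N m. norm (durfee_term Q L N m) \<le> B * norm Q ^ m"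
    using that by (rule durfee_term_geometric_bound[OF assms])
  thus ?thesis by (intro norm_suminf_le_geometric(1)[OF norm_ge_zero assms])
qed

lemma suminf_durfee_term_bounded:
  assumes "norm Q < 1"
  obtains B where "\<And>L N. norm (suminf (durfee_term Q L N)) \<le> B"
proof -
  obtain B where "B > 0" and B: "\<And>L N m. norm (durfee_term Q L N m) \<le> B * norm Q ^ m"
    using that by (rule durfee_term_geometric_bound[OF assms])
  have "norm (suminf (durfee_term Q L N)) \<le> B / (1 - norm Q)" for L N
    using B by (rule norm_suminf_le_geometric(2)[OF norm_ge_zero assms])
  thus ?thesis using that by blast
qed

text \<open>Creative telescoping with certificate \<open>a\<close>: summation over \<open>m\<close>
  turns it into a relation between three consecutive rectangle sums.\<close>

lemma durfee_term_telescope: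
  assumes "norm Q < 1"
  defines "a \<equiv> \<lambda>M m. (1 - Q ^ m) * durfee_term Q M (Suc M) m"
  shows "durfee_term Q M M m - durfee_term Q (Suc M) (Suc M) m
       + Q ^ Suc M * (durfee_term Q (Suc M) (Suc M) m
           - durfee_term Q (Suc (Suc M)) (Suc (Suc M)) m) = a M m - a M (Suc m)"
proof -
  \<comment> \<open>In these atoms every term is a rational function, so clearing the nonzero
    denominators leaves a polynomial identity.\<close>
  define p r where "p = qpoch Q Q m" and "r = qpoch Q Q (m + M)"
  define u v where "u = Q ^ m" and "v = Q ^ M"
  define w where "w = Q ^ (m ^ 2 + m * M)"
  have nz: "p \<noteq> 0" "r \<noteq> 0" "1 - Q * u \<noteq> 0" "1 - Q * (u * v) \<noteq> 0" "1 - Q * (Q * (u * v)) \<noteq> 0"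
    using qpoch_neq_0[OF assms(1)] one_minus_power_neq_0[OF assms(1), of m]
      one_minus_power_neq_0[OF assms(1), of "m + M"]
      one_minus_power_neq_0[OF assms(1), of "Suc (m + M)"]
    by (auto simp: p_def r_def u_def v_def power_add)
  have t0: "durfee_term Q M M m = w / (p * r)"
    by (simp add: durfee_term_def w_def p_def r_def)
  have t1: "durfee_term Q (Suc M) (Suc M) m = w * u / (p * (r * (1 - Q * (u * v))))"
    by (simp add: durfee_term_def w_def p_def r_def u_def v_def qpoch_Suc power_add)
  have t2: "durfee_term Q (Suc (Suc M)) (Suc (Suc M)) m
      = w * u * u / (p * (r * (1 - Q * (u * v)) * (1 - Q * (Q * (u * v)))))"
    by (simp add: durfee_term_def w_def p_def r_def u_def v_def qpoch_Suc power_add)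
  have a0: "a M m = (1 - u) * w / (p * (r * (1 - Q * (u * v))))"
    by (simp add: a_def durfee_term_def w_def p_def r_def u_def v_def qpoch_Suc power_add)
  have a1: "a M (Suc m) = (1 - Q * u) * (w * u * u * v * Q)
      / (p * (1 - Q * u) * (r * (1 - Q * (u * v)) * (1 - Q * (Q * (u * v)))))"
    by (simp add: a_def durfee_term_def w_def p_def r_def u_def v_def qpoch_Suc power_add
        power2_eq_square mult_ac)
  have QM: "Q ^ Suc M = Q * v" by (simp add: v_def)
  show ?thesis
    unfolding t0 t1 t2 a0 a1 QM using nz
    by (simp add: divide_simps) algebra
qed

lemma suminf_durfee_rectangle:
  assumes Q: "norm Q < 1"
  shows "suminf (durfee_term Q M M) = 1 / qpoch_inf Q Q"
proof -
  define C where "C M = suminf (durfee_term Q M M)" for M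
  obtain B where B: "\<And>M. norm (C M) \<le> B"
    using suminf_durfee_term_bounded[OF Q] unfolding C_def by metis
  note S = summable_durfee_term[OF Q]
  \<comment> \<open>The certificate contributes nothing: its factor \<open>1 - Q ^ m\<close>
    vanishes at \<open>m = 0\<close>, and its terms tend to 0.\<close>
  have "C M - C (Suc M) = - (Q ^ Suc M * (C (Suc M) - C (Suc (Suc M))))" for M
  proof -
    define a where "a m = (1 - Q ^ m) * durfee_term Q M (Suc M) m" for m
    have "(\<lambda>m. Q ^ m) \<longlonglongrightarrow> 0"
      using Q by (rule LIMSEQ_power_zero)
    hence "a \<longlonglongrightarrow> (1 - 0) * 0"
      unfolding a_def
      by (intro tendsto_mult[OF tendsto_diff[OF tendsto_const]] summable_LIMSEQ_zero[OF S])
    hence "(\<lambda>m. a m - a (Suc m)) sums (a 0 - 0)"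
      by (intro telescope_sums') simp
    moreover have "(\<lambda>m. a m - a (Suc m)) sums
        (C M - C (Suc M) + Q ^ Suc M * (C (Suc M) - C (Suc (Suc M))))"
      unfolding a_def durfee_term_telescope[OF Q, symmetric] C_def
      by (intro sums_add sums_diff sums_mult summable_sums S)
    ultimately have "C M - C (Suc M) + Q ^ Suc M * (C (Suc M) - C (Suc (Suc M))) = a 0 - 0"
      using sums_unique2 by blast
    thus ?thesis by (simp add: a_def eq_neg_iff_add_eq_0)
  qed
  moreover have "norm (C M - C (Suc M)) \<le> B + B" for M
    using B norm_triangle_ineq4 by (meson add_mono order_trans)
  ultimately have "C M - C (Suc M) = 0" for M
    by (rule eq_0_if_shift_contraction[OF Q])
  hence const: "C M = C 0" for M
    by (induction M) auto
  obtain B' where B': "B' > 0"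
    "\<And>L N m. norm (durfee_term Q L N m) \<le> B' * norm Q ^ (m ^ 2 + m * L)"
    using that by (rule durfee_term_bound[OF Q])
  \<comment> \<open>The term at \<open>m = 0\<close> is 1/(Q;Q)_M. After an index shift the other
    exponents are at least \<open>M + m\<close>, so the rest is of order
    \<open>norm Q ^ M\<close>.\<close>
  have tail: "norm (C M - 1 / qpoch Q Q M) \<le> norm Q ^ M * B' / (1 - norm Q)" for M
  proof -
    have "C M - 1 / qpoch Q Q M = (\<Sum>m. durfee_term Q M M (Suc m))"
      unfolding C_def using suminf_split_head[OF S] by (simp add: durfee_term_def)
    moreover have "norm (durfee_term Q M M (Suc m)) \<le> norm Q ^ M * B' * norm Q ^ m" for m
    proof -
      have "norm Q ^ (Suc m ^ 2 + Suc m * M) \<le> norm Q ^ (M + m)"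
        using Q by (intro power_decreasing) (auto simp: power2_eq_square)
      hence "B' * norm Q ^ (Suc m ^ 2 + Suc m * M) \<le> B' * norm Q ^ (M + m)"
        using B'(1) by simp
      thus ?thesis
        using order_trans[OF B'(2)] by (simp add: power_add mult_ac)
    qed
    ultimately show ?thesis
      using norm_suminf_le_geometric(2)[of "norm Q"] Q by simp
  qed
  have "(\<lambda>M. norm Q ^ M * B' / (1 - norm Q)) \<longlonglongrightarrow> 0 * B' / (1 - norm Q)"
    using Q by (intro tendsto_intros LIMSEQ_power_zero) auto
  hence "(\<lambda>M. C M - 1 / qpoch Q Q M) \<longlonglongrightarrow> 0"
    using tail by (intro Lim_null_comparison[of "\<lambda>M. C M - 1 / qpoch Q Q M"]) auto
  hence "(\<lambda>M. (C M - 1 / qpoch Q Q M) + 1 / qpoch Q Q M) \<longlonglongrightarrow> 0 + 1 / qpoch_inf Q Q"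
    by (intro tendsto_add inverse_qpoch_tendsto Q)
  hence "C \<longlonglongrightarrow> 1 / qpoch_inf Q Q" by simp
  moreover have "C \<longlonglongrightarrow> C 0"
    using const by (intro tendsto_eventually always_eventually) blast
  ultimately have "C 0 = 1 / qpoch_inf Q Q"
    using LIMSEQ_unique by blast
  thus ?thesis using const C_def by metis
qed

section \<open>Partial theta series\<close>

definition partial_theta_term :: "complex \<Rightarrow> nat \<Rightarrow> nat \<Rightarrow> complex" where
  "partial_theta_term Q N k = (-1) ^ k * Q ^ (k * (k + 1) div 2 + N * k)"

lemma norm_partial_theta_term_le:
  assumes "norm Q < 1"
  shows "norm (partial_theta_term Q N k) \<le> norm Q ^ k"
proof -
  have "k * 2 div 2 \<le> k * (k + 1) div 2"
    by (intro div_le_mono) (cases k, auto)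
  hence "k \<le> k * (k + 1) div 2 + N * k" by linarith
  thus ?thesis
    using assms unfolding partial_theta_term_def norm_mult norm_power
    by (simp add: power_decreasing)
qed

lemma summable_partial_theta_term:
  assumes "norm Q < 1"
  shows "summable (partial_theta_term Q N)"
  using norm_suminf_le_geometric(1)[of "norm Q" _ 1] norm_partial_theta_term_le assms by simp

text \<open>Split off \<open>k = 0\<close> and shift: (k+1)(k+2)/2 + N(k+1) = (N+1) + k(k+1)/2 +
  (N+1)k, with one extra sign.\<close>

lemma suminf_partial_theta_rec:
  assumes "norm Q < 1"
  shows "suminf (partial_theta_term Q N) = 1 - Q ^ Suc N * suminf (partial_theta_term Q (Suc N))"
proof -
  have "partial_theta_term Q N (Suc k) = - (Q ^ Suc N) * partial_theta_term Q (Suc N) k" for k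
  proof -
    have "Suc k * (Suc k + 1) = k * (k + 1) + Suc k * 2" by simp
    hence "Suc k * (Suc k + 1) div 2 = k * (k + 1) div 2 + Suc k"
      by (metis div_mult_self1 add.commute zero_neq_numeral)
    hence "Suc k * (Suc k + 1) div 2 + N * Suc k = Suc N + (k * (k + 1) div 2 + Suc N * k)"
      by simp
    thus ?thesis
      by (simp only: partial_theta_term_def power_add) (simp add: mult_ac)
  qed
  hence "(\<Sum>k. partial_theta_term Q N (Suc k))
      = - (Q ^ Suc N) * suminf (partial_theta_term Q (Suc N))"
    by (simp only: suminf_mult[OF summable_partial_theta_term[OF assms]])
  thus ?thesis
    using suminf_split_head[OF summable_partial_theta_term[OF assms], of N]
    by (simp add: partial_theta_term_def algebra_simps)
qed

lemma suminf_durfee_term_eq_partial_theta: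
  assumes Q: "norm Q < 1"
  shows "suminf (durfee_term Q (Suc N) N)
       = 1 / qpoch_inf Q Q * suminf (partial_theta_term Q N)"
proof -
  define P where "P = qpoch_inf Q Q"
  have P: "P \<noteq> 0" using qpoch_inf_neq_0[OF Q] by (simp add: P_def)
  define S R where "S N = suminf (durfee_term Q (Suc N) N)"
    and "R N = suminf (partial_theta_term Q N)" for N
  have S_rec: "S N + Q ^ Suc N * S (Suc N) = 1 / P" for N
  proof -
    \<comment> \<open>Write 1/(Q;Q)_{m+N} as (1 - Q^{m+N+1})/(Q;Q)_{m+N+1}; the second summand
      restores the subtracted part.\<close>
    have "durfee_term Q (Suc N) N m + Q ^ Suc N * durfee_term Q (Suc (Suc N)) (Suc N) m
        = durfee_term Q (Suc N) (Suc N) m" for m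
      using qpoch_neq_0[OF Q, of m] qpoch_neq_0[OF Q, of "m + N"]
        one_minus_power_neq_0[OF Q, of "m + N"]
      by (simp add: durfee_term_def qpoch_Suc divide_simps power_add) (simp add: algebra_simps)
    moreover have "(\<lambda>m. durfee_term Q (Suc N) N m
        + Q ^ Suc N * durfee_term Q (Suc (Suc N)) (Suc N) m) sums (S N + Q ^ Suc N * S (Suc N))"
      unfolding S_def by (intro sums_add sums_mult summable_sums summable_durfee_term Q)
    ultimately have "suminf (durfee_term Q (Suc N) (Suc N)) = S N + Q ^ Suc N * S (Suc N)"
      by (simp add: sums_iff)
    thus ?thesis using suminf_durfee_rectangle[OF Q] by (simp add: P_def)
  qed
  obtain B where B: "\<And>N. norm (S N) \<le> B"
    using suminf_durfee_term_bounded[OF Q] unfolding S_def by metis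
  have R_bound: "norm (R N) \<le> 1 / (1 - norm Q)" for N
    unfolding R_def using norm_partial_theta_term_le[OF Q] Q
    by (intro norm_suminf_le_geometric) auto
  \<comment> \<open>Both \<open>P * S N\<close> and \<open>R N\<close> are bounded and satisfy the
    same inhomogeneous recurrence; in the difference the constant 1 cancels.\<close>
  have "P * S N - R N = 0"
  proof (rule eq_0_if_shift_contraction[OF Q, where D = "\<lambda>N. P * S N - R N"])
    fix N
    have "P * S N = 1 - Q ^ Suc N * (P * S (Suc N))"
      using S_rec[of N] P by (simp add: field_simps)
    thus "P * S N - R N = - (Q ^ Suc N * (P * S (Suc N) - R (Suc N)))"
      using suminf_partial_theta_rec[OF Q, of N] by (simp add: R_def algebra_simps)
    have "norm (P * S N - R N) \<le> norm (P * S N) + norm (R N)"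
      by (rule norm_triangle_ineq4)
    also have "\<dots> \<le> norm P * B + 1 / (1 - norm Q)"
      unfolding norm_mult by (intro add_mono mult_left_mono B R_bound) auto
    finally show "norm (P * S N - R N) \<le> norm P * B + 1 / (1 - norm Q)" .
  qed
  thus ?thesis using P by (simp add: P_def S_def R_def field_simps)
qed

section \<open>The finite Jacobi triple product\<close>

text \<open>
  \<open>q\<close>-binomial form of the coefficient of \<open>z\<^sup>j\<close> in \<open>\<Prod>\<^sub>i (1 + z q\<^bsup>2i-1\<^esup>) (1 + q\<^bsup>2i-1\<^esup> / z)\<close>.
\<close>

definition jtp_coeff :: "complex \<Rightarrow> nat \<Rightarrow> nat \<Rightarrow> complex" where
  "jtp_coeff q n j = (if j \<le> n then q ^ (j ^ 2) * qpoch (q ^ 2) (q ^ 2) (2 * n) /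
     (qpoch (q ^ 2) (q ^ 2) (n - j) * qpoch (q ^ 2) (q ^ 2) (n + j)) else 0)"

text \<open>
  The two boundary terms on the left vanish for coefficients supported on \<open>{..n}\<close>; keeping them
  makes the identity inductive.
\<close>

lemma cheb_VV_sum_mult:
  fixes e :: "nat \<Rightarrow> complex"
  shows "2 * x * (\<Sum>j\<le>n. cheb_VV x j * e j) + (if n = 0 then 2 else cheb_VV x n) * e (Suc n)
           + cheb_VV x (Suc n) * e (Suc (Suc n))
       = 2 * e 1 + (\<Sum>j\<le>n. cheb_VV x (Suc j) * (e j + e (Suc (Suc j))))"
proof (induction n)
  case 0
  show ?case by (simp add: algebra_simps)
next
  case (Suc n)
  have "2 * x * cheb_VV x (Suc n) = cheb_VV x (Suc (Suc n)) + (if n = 0 then 2 else cheb_VV x n)"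
    by (simp add: cheb_VV_Suc_Suc)
  thus ?case using Suc.IH by (simp add: ring_distribs) algebra
qed

text \<open>The next factor is 1 + q^{4n+2} + q^{2n+1}(z + 1/z); this reads off the coefficient of
  z^j. At \<open>j = 0\<close> the coefficient of 1/z is replaced by that of z, by symmetry.\<close>

lemma jtp_coeff_Suc:
  assumes "norm q < 1" "j \<le> n"
  shows "jtp_coeff q (Suc n) j = (1 + q ^ (4 * n + 2)) * jtp_coeff q n j
     + q ^ (2 * n + 1) * (jtp_coeff q n (if j = 0 then 1 else j - 1) + jtp_coeff q n (Suc j))"
proof -
  define Q where "Q = q ^ 2"
  have Q: "norm Q < 1"
    using assms(1) by (simp add: Q_def norm_power power_less_one_iff)
  \<comment> \<open>Up to powers of \<open>q\<close>, each coefficient is \<open>W\<close> times a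
    polynomial in \<open>Q\<close>, \<open>A\<close>, \<open>B\<close>, which reduces the claim to a
    polynomial identity.\<close>
  define A B where "A = Q ^ (n - j)" and "B = Q ^ (n + j)"
  define W where "W = qpoch Q Q (2 * n) / (qpoch Q Q (Suc n - j) * qpoch Q Q (Suc n + j))"
  have nz: "qpoch Q Q k \<noteq> 0" "1 - Q * Q ^ k \<noteq> 0" for k
    using qpoch_neq_0[OF Q] one_minus_power_neq_0[OF Q] by auto
  have AB: "Q ^ (2 * n) = A * B"
    using assms(2) by (simp add: A_def B_def mult_2 flip: power_add)
  have lo: "qpoch Q Q (Suc n - j) = qpoch Q Q (n - j) * (1 - Q * A)"
    using assms(2) by (simp add: Suc_diff_le qpoch_Suc A_def)
  have hi: "qpoch Q Q (Suc n + j) = qpoch Q Q (n + j) * (1 - Q * B)"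
    by (simp add: qpoch_Suc B_def)
  have e_same: "jtp_coeff q n j = q ^ (j ^ 2) * ((1 - Q * A) * (1 - Q * B) * W)"
    using assms(2) nz nz(2)[of "n - j"] nz(2)[of "n + j"]
    by (simp add: jtp_coeff_def W_def lo hi[unfolded add_Suc] A_def B_def flip: Q_def)
  have e_new: "jtp_coeff q (Suc n) j
      = q ^ (j ^ 2) * ((1 - Q * (A * B)) * (1 - Q * (Q * (A * B))) * W)"
    using assms(2) by (simp add: jtp_coeff_def W_def qpoch_Suc AB flip: Q_def)
  \<comment> \<open>For \<open>j = n\<close> the factor \<open>1 - A\<close> vanishes, in agreement
    with the default value 0 of \<open>jtp_coeff\<close>.\<close>
  have e_up: "jtp_coeff q n (Suc j) = q ^ (Suc j ^ 2) * ((1 - A) * (1 - Q * A) * W)"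
  proof (cases "j = n")
    case True
    thus ?thesis by (simp add: jtp_coeff_def A_def)
  next
    case False
    then obtain d where d: "n = j + Suc d"
      using assms(2) by (metis le_neq_implies_less less_imp_Suc_add add_Suc_right)
    hence "qpoch Q Q (n - j) = qpoch Q Q (n - Suc j) * (1 - A)" "1 - A \<noteq> 0"
      using nz(2)[of d] by (simp_all add: qpoch_Suc A_def)
    moreover have "1 - Q * A \<noteq> 0" using nz by (simp add: A_def)
    ultimately have "W * ((1 - A) * (1 - Q * A))
        = qpoch Q Q (2 * n) / (qpoch Q Q (n - Suc j) * qpoch Q Q (n + Suc j))"
      by (simp add: W_def lo)
    thus ?thesis
      using d by (simp add: jtp_coeff_def mult_ac flip: Q_def)
  qed
  have up: "q ^ (2 * n + 1) * jtp_coeff q n (Suc j)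
      = q ^ (j ^ 2) * (Q * B * (1 - A) * (1 - Q * A) * W)"
  proof -
    have "2 * n + 1 + Suc j ^ 2 = j ^ 2 + (2 + 2 * (n + j))"
      by (simp add: power2_eq_square)
    hence "q ^ (2 * n + 1) * q ^ (Suc j ^ 2) = q ^ (j ^ 2) * (Q * B)"
      by (simp only: Q_def B_def flip: power_add power_mult)
    thus ?thesis unfolding e_up by (simp only: flip: mult.assoc)
  qed
  have down: "q ^ (2 * n + 1) * jtp_coeff q n (if j = 0 then 1 else j - 1)
      = q ^ (j ^ 2) * (Q * A * (1 - B) * (1 - Q * B) * W)"
  proof (cases j)
    case 0
    \<comment> \<open>Here \<open>A = B\<close>, and both neighbours are the coefficient at index
      1.\<close>
    thus ?thesis using up by (simp add: A_def B_def)
  next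
    case (Suc i)
    obtain d where d: "n = Suc i + d"
      using assms(2) Suc by (metis le_iff_add)
    have "B = Q * Q ^ (n + i)" by (simp add: B_def Suc)
    hence "qpoch Q Q (n + j) = qpoch Q Q (n + i) * (1 - B)" "1 - B \<noteq> 0"
      using nz(2)[of "n + i"] by (simp_all add: qpoch_Suc Suc)
    moreover have "1 - Q * B \<noteq> 0" using nz by (simp add: B_def)
    moreover have "n - i = Suc n - j" "i \<le> n" using Suc d by auto
    ultimately have e_down: "jtp_coeff q n i = q ^ (i ^ 2) * ((1 - B) * (1 - Q * B) * W)"
      using nz by (simp add: jtp_coeff_def W_def hi[unfolded add_Suc] flip: Q_def)
    have "2 * n + 1 + i ^ 2 = j ^ 2 + (2 + 2 * (n - j))"
      using d Suc by (simp add: power2_eq_square)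
    hence "q ^ (2 * n + 1) * q ^ (i ^ 2) = q ^ (j ^ 2) * (Q * A)"
      by (simp only: Q_def A_def flip: power_add power_mult)
    hence "q ^ (2 * n + 1) * jtp_coeff q n i = q ^ (j ^ 2) * (Q * A * (1 - B) * (1 - Q * B) * W)"
      unfolding e_down by (simp only: flip: mult.assoc)
    thus ?thesis using Suc by simp
  qed
  have "4 * n + 2 = 2 * Suc (2 * n)" by simp
  hence "q ^ (4 * n + 2) = Q ^ Suc (2 * n)"
    by (simp only: Q_def flip: power_mult)
  hence Q4: "q ^ (4 * n + 2) = Q * (A * B)" using AB by simp
  have "c * ((1 - Q * (A * B)) * (1 - Q * (Q * (A * B))) * W)
      = (1 + Q * (A * B)) * (c * ((1 - Q * A) * (1 - Q * B) * W))
        + (c * (Q * A * (1 - B) * (1 - Q * B) * W) + c * (Q * B * (1 - A) * (1 - Q * A) * W))" for c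
    by algebra
  thus ?thesis
    unfolding distrib_left[of "q ^ (2 * n + 1)"] up down e_same e_new Q4 .
qed

text \<open>The coefficients of z^j and z^{-j} agree, so the Laurent polynomial collapses to a sum
  over \<open>j \<ge> 0\<close> of \<open>cheb_VV\<close>. The induction multiplies by the next
  factor, where z + 1/z is \<open>2 * x\<close>.\<close>

lemma finite_jacobi_triple_product:
  assumes "norm q < 1"
  shows "(\<Prod>i=1..n. 1 + 2 * x * q ^ (2 * i - 1) + q ^ (4 * i - 2))
       = (\<Sum>j\<le>n. cheb_VV x j * jtp_coeff q n j)"
proof (induction n)
  case 0
  show ?case by (simp add: jtp_coeff_def)
next
  case (Suc n)
  define e where "e = jtp_coeff q n"
  define a b where "a = q ^ (4 * n + 2)" and "b = q ^ (2 * n + 1)"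
  have rec: "jtp_coeff q (Suc n) j
      = (1 + a) * e j + b * (e (if j = 0 then 1 else j - 1) + e (Suc j))" if "j \<le> n" for j
    unfolding e_def a_def b_def by (rule jtp_coeff_Suc[OF assms that])
  have [simp]: "e (Suc n) = 0" "e (Suc (Suc n)) = 0"
    by (simp_all add: e_def jtp_coeff_def)
  have Q: "norm (q ^ 2) < 1"
    using assms by (simp add: norm_power power_less_one_iff)
  \<comment> \<open>The new top index lies outside the range of \<open>jtp_coeff_Suc\<close> and is
    computed directly.\<close>
  have last: "jtp_coeff q (Suc n) (Suc n) = b * e n"
  proof -
    have "n + n = 2 * n" by simp
    moreover have "Suc n ^ 2 = (2 * n + 1) + n ^ 2" by (simp add: power2_eq_square)
    ultimately show ?thesis
      using qpoch_neq_0[OF Q] by (simp add: jtp_coeff_def e_def b_def power_add mult_2)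
  qed
  have step: "jtp_coeff q (Suc n) (Suc j) = (1 + a) * e (Suc j) + b * (e j + e (Suc (Suc j)))"
    if "j \<le> n" for j
  proof (cases "j = n")
    case True
    thus ?thesis using last by simp
  next
    case False
    thus ?thesis using rec[of "Suc j"] that by simp
  qed
  have "(\<Sum>j\<le>Suc n. cheb_VV x j * jtp_coeff q (Suc n) j)
      = jtp_coeff q (Suc n) 0 + (\<Sum>j\<le>n. cheb_VV x (Suc j) * jtp_coeff q (Suc n) (Suc j))"
    by (subst sum.atMost_Suc_shift) simp
  also have "(\<Sum>j\<le>n. cheb_VV x (Suc j) * jtp_coeff q (Suc n) (Suc j))
      = (\<Sum>j\<le>n. (1 + a) * (cheb_VV x (Suc j) * e (Suc j))
           + b * (cheb_VV x (Suc j) * (e j + e (Suc (Suc j)))))"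
    by (intro sum.cong refl) (simp add: step algebra_simps)
  also have "\<dots> = (1 + a) * (\<Sum>j\<le>n. cheb_VV x (Suc j) * e (Suc j))
      + b * (\<Sum>j\<le>n. cheb_VV x (Suc j) * (e j + e (Suc (Suc j))))"
    by (simp only: sum.distrib sum_distrib_left)
  \<comment> \<open>The boundary terms drop out because \<open>e\<close> vanishes at
    \<open>Suc n\<close> and \<open>Suc (Suc n)\<close>.\<close>
  also have "(\<Sum>j\<le>n. cheb_VV x (Suc j) * (e j + e (Suc (Suc j))))
      = 2 * x * (\<Sum>j\<le>n. cheb_VV x j * e j) - 2 * e 1"
    using cheb_VV_sum_mult[of x e n] by simp
  also have "(\<Sum>j\<le>n. cheb_VV x (Suc j) * e (Suc j)) = (\<Sum>j\<le>n. cheb_VV x j * e j) - e 0"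
    using sum.atMost_Suc_shift[of "\<lambda>j. cheb_VV x j * e j" n] by simp
  also have "jtp_coeff q (Suc n) 0 = (1 + a) * e 0 + 2 * b * e 1"
    using rec[of 0] by simp
  finally have "(\<Sum>j\<le>Suc n. cheb_VV x j * jtp_coeff q (Suc n) j)
      = (\<Sum>j\<le>n. cheb_VV x j * e j) * (1 + 2 * x * b + a)"
    by (simp add: algebra_simps)
  thus ?case
    using Suc.IH by (simp add: e_def a_def b_def)
qed

section \<open>Rearrangement of double series\<close>

text \<open>The family \<open>g j * u j m\<close> is absolutely summable over all pairs, since the
  geometric bound on \<open>u\<close> is uniform in \<open>j\<close>. Summation by rows gives the
  right side, summation along the lines \<open>m + s * j = n\<close> the left.\<close>

lemma diagonal_sums:
  fixes g :: "nat \<Rightarrow> complex" and u :: "nat \<Rightarrow> nat \<Rightarrow> complex"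
  assumes s: "s > 0" and g: "summable (\<lambda>j. norm (g j))"
    and r: "0 \<le> r" "r < 1" and u: "\<And>j m. norm (u j m) \<le> B * r ^ m"
  shows "(\<lambda>n. \<Sum>j\<le>n div s. g j * u j (n - s * j)) sums (\<Sum>j. g j * suminf (u j))"
    and "summable (\<lambda>j. g j * suminf (u j))"
proof -
  define f where "f = (\<lambda>(j, m). g j * u j m)"
  have sum_u: "summable (\<lambda>m. norm (u j m))" for j
  proof (rule summable_comparison_test')
    show "summable (\<lambda>m. B * r ^ m)"
      using r by (intro summable_mult summable_geometric) simp
    show "norm (norm (u j m)) \<le> B * r ^ m" for m
      using u by simp
  qed
  have "f summable_on UNIV \<times> UNIV"
  proof (rule abs_summable_summable,
      rule Infinite_Sum.abs_summable_on_Sigma_iff[THEN iffD2], intro conjI ballI)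
    show row: "(\<lambda>m. norm (f (j, m))) summable_on UNIV" for j
      unfolding f_def using sum_u[of j]
      by (intro norm_summable_imp_summable_on) (auto simp: norm_mult intro: summable_mult)
    have "summable (\<lambda>j. norm (\<Sum>\<^sub>\<infinity>m. norm (f (j, m))))"
    proof (rule summable_comparison_test')
      show "summable (\<lambda>j. norm (g j) * (B / (1 - r)))"
        using g by (rule summable_mult2)
      fix j
      have major: "(\<lambda>m. norm (g j) * (B * r ^ m)) sums (norm (g j) * (B * (1 / (1 - r))))"
        using r by (intro sums_mult geometric_sums) auto
      have minor: "(\<lambda>m. norm (f (j, m))) sums (\<Sum>\<^sub>\<infinity>m. norm (f (j, m)))"
        using row by (intro has_sum_imp_sums has_sum_infsum)
      have "(\<Sum>\<^sub>\<infinity>m. norm (f (j, m))) \<le> norm (g j) * (B * (1 / (1 - r)))"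
        by (rule sums_le[OF _ minor major]) (auto simp: f_def norm_mult intro: mult_left_mono u)
      thus "norm (norm (\<Sum>\<^sub>\<infinity>m. norm (f (j, m)))) \<le> norm (g j) * (B / (1 - r))"
        by (simp add: infsum_nonneg)
    qed
    thus "(\<lambda>j. norm (\<Sum>\<^sub>\<infinity>m. norm (f (j, m)))) summable_on UNIV"
      by (intro norm_summable_imp_summable_on) simp
  qed
  then obtain T where T: "(f has_sum T) (UNIV \<times> UNIV)"
    by (auto simp: summable_on_def)
  have "((\<lambda>j. g j * suminf (u j)) has_sum T) UNIV"
  proof (rule has_sum_SigmaD[OF T])
    show "((\<lambda>m. f (j, m)) has_sum g j * suminf (u j)) UNIV" for j
      unfolding f_def using sum_u[of j]
      by (auto intro!: has_sum_cmult_right norm_summable_imp_has_sum summable_sums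
          summable_norm_cancel)
  qed
  hence sums_T: "(\<lambda>j. g j * suminf (u j)) sums T"
    by (rule has_sum_imp_sums)
  thus "summable (\<lambda>j. g j * suminf (u j))"
    by (rule sums_summable)
  \<comment> \<open>The condition \<open>j \<le> n div s\<close> means \<open>s * j \<le> n\<close>,
    so the natural subtraction is not truncated and the map can be inverted.\<close>
  have bij: "bij_betw (\<lambda>(n, j). (j, n - s * j)) (SIGMA n:UNIV. {..n div s}) (UNIV \<times> UNIV)"
  proof (rule bij_betwI[where g = "\<lambda>(j, m). (m + s * j, j)"])
    show "(\<lambda>(j, m). (m + s * j, j)) \<in> UNIV \<times> UNIV \<rightarrow> (SIGMA n:UNIV. {..n div s})"
      using s by auto
  qed (use s in \<open>auto simp: less_eq_div_iff_mult_less_eq mult.commute\<close>)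
  have "((\<lambda>p. f (case p of (n, j) \<Rightarrow> (j, n - s * j))) has_sum T) (SIGMA n:UNIV. {..n div s})"
    using has_sum_reindex_bij_betw[OF bij, of f T] T by simp
  hence "((\<lambda>n. \<Sum>j\<le>n div s. g j * u j (n - s * j)) has_sum T) UNIV"
    by (rule has_sum_SigmaD) (auto simp: f_def intro!: has_sum_finiteI)
  hence "(\<lambda>n. \<Sum>j\<le>n div s. g j * u j (n - s * j)) sums T"
    by (rule has_sum_imp_sums)
  thus "(\<lambda>n. \<Sum>j\<le>n div s. g j * u j (n - s * j)) sums (\<Sum>j. g j * suminf (u j))"
    using sums_unique[OF sums_T] by simp
qed

section \<open>Comparison of the two sides\<close>

text \<open>The hypothesis is shaped by \<open>q = 0\<close>, where a negative power is 0: for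
  \<open>a = b > 0\<close> the left side would be 0 and the right side 1.\<close>

lemma power_mult_powi_minus:
  fixes q :: complex
  assumes "b < a \<or> b = 0"
  shows "q ^ a * q powi (- int b) = q ^ (a - b)"
  using assms
  by (cases "q = 0") (auto simp: power_int_minus power_diff power_0_left field_simps)

theorem theorem7p1:
  fixes q x :: complex
  assumes "norm q < 1"
  shows "summable (\<lambda>n::nat. q ^ (2 * n ^ 2 + 2 * n) *
             (\<Prod>i=1..n. 1 + 2 * x * q ^ (2 * i - 1) + q ^ (4 * i - 2)) / qpoch (q ^ 2) (q ^ 2) (2 * n))
       \<and> summable (\<lambda>n::nat. (-1) ^ n * q ^ (n ^ 2 + n) *
             (\<Sum>j=0..n div 2. q powi (- (int j ^ 2)) *
                (chebyshev_V (int j) x + chebyshev_V (int j - 1) x)))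
       \<and> (\<Sum>n::nat. q ^ (2 * n ^ 2 + 2 * n) *
             (\<Prod>i=1..n. 1 + 2 * x * q ^ (2 * i - 1) + q ^ (4 * i - 2)) / qpoch (q ^ 2) (q ^ 2) (2 * n))
         = 1 / qpoch_inf (q ^ 2) (q ^ 2) *
           (\<Sum>n::nat. (-1) ^ n * q ^ (n ^ 2 + n) *
             (\<Sum>j=0..n div 2. q powi (- (int j ^ 2)) *
                (chebyshev_V (int j) x + chebyshev_V (int j - 1) x)))"
proof -
  define Q where "Q = q ^ 2"
  have Q: "norm Q < 1"
    using assms by (simp add: Q_def norm_power power_less_one_iff)
  \<comment> \<open>This is the weight common to both sides: 2n^2 + 2n + j^2 at n = j + m and n^2 +
    n - j^2 at n = 2j + k both leave 3j^2 + 2j once an even exponent, a power of \<open>Q\<close>,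
    is split off.\<close>
  define g where "g j = cheb_VV x j * q ^ (3 * j ^ 2 + 2 * j)" for j
  have g: "summable (\<lambda>j. norm (g j))"
    unfolding g_def by (rule summable_cheb_VV_mult_power_square[OF assms]) simp
  define lhs where "lhs n = q ^ (2 * n ^ 2 + 2 * n) *
    (\<Prod>i=1..n. 1 + 2 * x * q ^ (2 * i - 1) + q ^ (4 * i - 2)) / qpoch (q ^ 2) (q ^ 2) (2 * n)" for n
  define rhs where "rhs n = (-1) ^ n * q ^ (n ^ 2 + n) *
    (\<Sum>j=0..n div 2. q powi (- (int j ^ 2)) *
      (chebyshev_V (int j) x + chebyshev_V (int j - 1) x))" for n
  obtain B where "B > 0" and B: "\<And>L N m. norm (durfee_term Q L N m) \<le> B * norm Q ^ m"
    using that by (rule durfee_term_geometric_bound[OF Q])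
  \<comment> \<open>The forms \<open>n div 1\<close> and \<open>1 * j\<close> match
    \<open>diagonal_sums\<close> with \<open>s = 1\<close>.\<close>
  have lhs_eq: "lhs n = (\<Sum>j\<le>n div 1. g j * durfee_term Q (Suc (2 * j)) (2 * j) (n - 1 * j))" for n
  proof -
    have "q ^ (2 * n ^ 2 + 2 * n) * (cheb_VV x j * jtp_coeff q n j) / qpoch Q Q (2 * n)
        = g j * durfee_term Q (Suc (2 * j)) (2 * j) (n - j)" if jn: "j \<le> n" for j
    proof -
      obtain m where m: "n = j + m" using le_Suc_ex[OF jn] by blast
      have "2 * n ^ 2 + 2 * n + j ^ 2 = 3 * j ^ 2 + 2 * j + 2 * (m ^ 2 + m * Suc (2 * j))"
        unfolding m by (simp add: power2_eq_square algebra_simps)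
      hence "q ^ (2 * n ^ 2 + 2 * n) * q ^ (j ^ 2)
          = q ^ (3 * j ^ 2 + 2 * j) * Q ^ (m ^ 2 + m * Suc (2 * j))"
        by (simp only: Q_def flip: power_add power_mult)
      note E = this
      have J: "jtp_coeff q n j / qpoch Q Q (2 * n)
          = q ^ (j ^ 2) / (qpoch Q Q m * qpoch Q Q (m + 2 * j))"
        using qpoch_neq_0[OF Q] m
        by (simp add: jtp_coeff_def mult_2 add_ac flip: Q_def)
      have "q ^ (2 * n ^ 2 + 2 * n) * (cheb_VV x j * jtp_coeff q n j) / qpoch Q Q (2 * n)
          = cheb_VV x j * q ^ (2 * n ^ 2 + 2 * n) * (jtp_coeff q n j / qpoch Q Q (2 * n))"
        by simp
      also have "\<dots> = cheb_VV x j * (q ^ (2 * n ^ 2 + 2 * n) * q ^ (j ^ 2))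
          / (qpoch Q Q m * qpoch Q Q (m + 2 * j))"
        unfolding J by simp
      also have "\<dots> = g j * durfee_term Q (Suc (2 * j)) (2 * j) m"
        unfolding E g_def durfee_term_def by simp
      finally show ?thesis using m by simp
    qed
    thus ?thesis
      unfolding lhs_def finite_jacobi_triple_product[OF assms]
      by (simp add: sum_distrib_left sum_divide_distrib flip: Q_def)
  qed
  have rhs_eq: "rhs n = (\<Sum>j\<le>n div 2. g j * partial_theta_term Q (2 * j) (n - 2 * j))" for n
  proof -
    have "(-1) ^ n * q ^ (n ^ 2 + n) * (q powi (- (int j ^ 2)) * cheb_VV x j)
        = g j * partial_theta_term Q (2 * j) (n - 2 * j)" if "j \<le> n div 2" for j
    proof -
      have "2 * j \<le> n" using that by simp
      then obtain k where k: "n = 2 * j + k" using le_Suc_ex by blast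
      have tri: "2 * (k * (k + 1) div 2) = k * (k + 1)" by simp
      have "n ^ 2 + n = j ^ 2 + (3 * j ^ 2 + 2 * j + (k * (k + 1) + 2 * (2 * j * k)))"
        unfolding k by (simp add: power2_eq_square algebra_simps)
      hence e: "n ^ 2 + n = j ^ 2 + (3 * j ^ 2 + 2 * j + 2 * (k * (k + 1) div 2 + 2 * j * k))"
        unfolding distrib_left[of 2] tri .
      \<comment> \<open>For \<open>j > 0\<close> the exponent \<open>n ^ 2 + n\<close> strictly
        exceeds \<open>j ^ 2\<close>, as the case \<open>q = 0\<close> demands.\<close>
      have "q ^ (n ^ 2 + n) * q powi (- (int j ^ 2)) = q ^ (n ^ 2 + n - j ^ 2)"
        using power_mult_powi_minus[of "j ^ 2" "n ^ 2 + n" q] e by (cases "j = 0") auto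
      also have "\<dots> = q ^ (3 * j ^ 2 + 2 * j) * Q ^ (k * (k + 1) div 2 + 2 * j * k)"
        by (simp only: e Q_def diff_add_inverse flip: power_add power_mult)
      finally have "q ^ (n ^ 2 + n) * q powi (- (int j ^ 2))
        = q ^ (3 * j ^ 2 + 2 * j) * Q ^ (k * (k + 1) div 2 + 2 * j * k)" .
      hence "(-1) ^ n * (q ^ (n ^ 2 + n) * q powi (- (int j ^ 2))) * cheb_VV x j
          = (-1) ^ n * (q ^ (3 * j ^ 2 + 2 * j) * Q ^ (k * (k + 1) div 2 + 2 * j * k))
            * cheb_VV x j"
        by simp
      moreover have "(-1::complex) ^ n = (-1) ^ k" "n - 2 * j = k" by (simp_all add: k power_add)
      ultimately show ?thesis
        unfolding g_def partial_theta_term_def by (simp only: mult_ac)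
    qed
    thus ?thesis
      by (simp add: rhs_def sum_distrib_left atLeast0AtMost flip: cheb_VV_def)
  qed
  have L: "lhs sums (\<Sum>j. g j * suminf (durfee_term Q (Suc (2 * j)) (2 * j)))"
    unfolding lhs_eq using B by (rule diagonal_sums(1)[OF zero_less_one g norm_ge_zero Q])
  have R: "rhs sums (\<Sum>j. g j * suminf (partial_theta_term Q (2 * j)))"
    unfolding rhs_eq using norm_partial_theta_term_le[OF Q] Q g
    by (intro diagonal_sums(1)[where B = 1]) auto
  \<comment> \<open>This conclusion does not mention \<open>s\<close>, so any positive value serves;
    it allows the constant factor to be pulled out of the sum.\<close>
  have "summable (\<lambda>j. g j * suminf (partial_theta_term Q (2 * j)))"
    using norm_partial_theta_term_le[OF Q] Q g
    by (intro diagonal_sums(2)[where B = 1 and s = 1]) auto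
  hence "(\<Sum>j. 1 / qpoch_inf Q Q * (g j * suminf (partial_theta_term Q (2 * j))))
      = 1 / qpoch_inf Q Q * (\<Sum>j. g j * suminf (partial_theta_term Q (2 * j)))"
    by (rule suminf_mult)
  hence "suminf lhs = 1 / qpoch_inf Q Q * suminf rhs"
    using sums_unique[OF L] sums_unique[OF R]
    by (simp add: suminf_durfee_term_eq_partial_theta[OF Q] mult_ac)
  thus ?thesis
    using L R unfolding lhs_def rhs_def Q_def by (auto simp: sums_iff)
qed

end
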